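(* Let $A\in\mathbb{R}^{2\times 2}$, let $\zeta\in\mathbb{R}^2$ be nonzero, let $\Omega=[u^-,u^+]$ with $u^-<u^+$, and consider the linear control system $\Sigma_{\mathbb{R}^2}$: $\dot v(t)=Av(t)+u(t)\zeta$, $u(t)\in\Omega$. Assume that $\Sigma_{\mathbb{R}^2}$ satisfies the LARC, that $\det A=0$ and that $\operatorname{tr}A\neq 0$. Then there exists a basis $\{\mathbf{e}_1,\mathbf{e}_2\}$ of $\mathbb{R}^2$ in which $A=\begin{pmatrix}\mu&0\\0&0\end{pmatrix}$ with $\mu=\operatorname{tr}A\ne 0$, and $\zeta=\zeta_1\mathbf{e}_1+\zeta_2\mathbf{e}_2$, such that: (a) if $0\in\operatorname{int}\Omega$, then $\Sigma_{\mathbb{R}^2}$ admits a unique control set $\mathcal{C}_{\mathbb{R}^2}$, which in coordinates with respect to $\{\mathbf{e}_1,\mathbf{e}_2\}$ is $$\mathcal{C}_{\mathbb{R}^2}=-\frac{\zeta_1}{\mu}\Omega\times\mathbb{R}\ \text{ if }\mu<0,\qquad \mathcal{C}_{\mathbb{R}^2}=-\frac{\zeta_1}{\mu}\operatorname{int}\Omega\times\mathbb{R}\ \text{ if }\mu>0;$$ (b) if $0\in\partial\Omega$, then $\mathbb{R}\cdot\mathbf{e}_2$ is a continuum of one-point control sets, i.e. for every $\alpha\in\mathbb{R}$ the singleton $\{\alpha\mathbf{e}_2\}$ is a control set of $\Sigma_{\mathbb{R}^2}$; (c) if $0\notin\Omega$, then $\Sigma_{\mathbb{R}^2}$ does not admit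 any control set.
   Context: The set $\mathcal{U}$ of control functions consists of all piecewise constant functions $\mathbf{u}:\mathbb{R}\to\mathbb{R}$ with image in $\Omega$. For $v\in\mathbb{R}^2$ and $\mathbf{u}\in\mathcal{U}$, $s\mapsto\varphi(s,v,\mathbf{u})$, $s\in\mathbb{R}$, is the unique continuous, piecewise differentiable solution of $\frac{d}{ds}\varphi(s,v,\mathbf{u})=A\varphi(s,v,\mathbf{u})+\mathbf{u}(s)\zeta$ with $\varphi(0,v,\mathbf{u})=v$. The positive orbit of $v$ is $\mathcal{O}^+(v)=\{\varphi(t,v,\mathbf{u}): t\ge 0,\ \mathbf{u}\in\mathcal{U}\}$. LARC: $\langle A\zeta,\theta\zeta\rangle\neq 0$, where $\theta$ is the counter-clockwise rotation by $\pi/2$; equivalently, $\zeta$ is not an eigenvector of $A$. A nonempty set $\mathcal{C}\subset\mathbb{R}^2$ is a control set of $\Sigma_{\mathbb{R}^2}$ if: (1) for every $v\in\mathcal{C}$ there is $\mathbf{u}\in\mathcal{U}$ with $\varphi(t,v,\mathbf{u})\in\mathcal{C}$ for all $t\geq 0$; (2) for every $v\in\mathcal{C}$, $\mathcal{C}\subset\overline{\mathcal{O}^+(v)}$; (3) $\mathcal{C}$ is maximal with respect to set inclusion among sets satisfying (1) and (2). For $c\in\mathbb{R}$ and $S\subset\mathbb{R}$, $cS=\{cs:s\in S\}$. *)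

theory Defs
  imports "HOL-Analysis.Analysis"
begin

definition locally_finite_real :: "real set \<Rightarrow> bool" where
  "locally_finite_real D \<longleftrightarrow> (\<forall>a b. finite (D \<inter> {a..b}))"

(* A piecewise constant function may have infinitely many switching points on the whole line,
   but only finitely many in each bounded interval; its values at the switching points are
   arbitrary. *)
definition piecewise_constant :: "(real \<Rightarrow> real) \<Rightarrow> bool" where
  "piecewise_constant u \<longleftrightarrow>
     (\<exists>D. locally_finite_real D \<and> (\<forall>I. is_interval I \<and> I \<inter> D = {} \<longrightarrow> u constant_on I))"

definition controls :: "real set \<Rightarrow> (real \<Rightarrow> real) set" where
  "controls \<Omega> = {u. piecewise_constant u \<and> range u \<subseteq> \<Omega>}"

(* A continuous, piecewise differentiable solution satisfies the differential equation
   except at a locally finite set of times. *)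
definition is_solution ::
  "real^2^2 \<Rightarrow> real^2 \<Rightarrow> (real \<Rightarrow> real) \<Rightarrow> real^2 \<Rightarrow> (real \<Rightarrow> real^2) \<Rightarrow> bool" where
  "is_solution A \<zeta> u v f \<longleftrightarrow>
     continuous_on UNIV f \<and> f 0 = v \<and>
     (\<exists>D. locally_finite_real D \<and>
        (\<forall>s. s \<notin> D \<longrightarrow> (f has_vector_derivative (A *v f s + u s *\<^sub>R \<zeta>)) (at s)))"

definition \<phi> :: "real^2^2 \<Rightarrow> real^2 \<Rightarrow> real \<Rightarrow> real^2 \<Rightarrow> (real \<Rightarrow> real) \<Rightarrow> real^2" where
  "\<phi> A \<zeta> s v u = (THE f. is_solution A \<zeta> u v f) s"

definition positive_orbit :: "real^2^2 \<Rightarrow> real^2 \<Rightarrow> real set \<Rightarrow> real^2 \<Rightarrow> (real^2) set" where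
  "positive_orbit A \<zeta> \<Omega> v = {\<phi> A \<zeta> t v u | t u. t \<ge> 0 \<and> u \<in> controls \<Omega>}"

definition \<theta> :: "real^2^2" where
  "\<theta> = vector [vector [0, -1], vector [1, 0]]"

definition LARC :: "real^2^2 \<Rightarrow> real^2 \<Rightarrow> bool" where
  "LARC A \<zeta> \<longleftrightarrow> (A *v \<zeta>) \<bullet> (\<theta> *v \<zeta>) \<noteq> 0"

definition pre_control_set :: "real^2^2 \<Rightarrow> real^2 \<Rightarrow> real set \<Rightarrow> (real^2) set \<Rightarrow> bool" where
  "pre_control_set A \<zeta> \<Omega> C \<longleftrightarrow>
     (\<forall>v\<in>C. \<exists>u\<in>controls \<Omega>. \<forall>t\<ge>0. \<phi> A \<zeta> t v u \<in> C) \<and>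
     (\<forall>v\<in>C. C \<subseteq> closure (positive_orbit A \<zeta> \<Omega> v))"

definition control_set :: "real^2^2 \<Rightarrow> real^2 \<Rightarrow> real set \<Rightarrow> (real^2) set \<Rightarrow> bool" where
  "control_set A \<zeta> \<Omega> C \<longleftrightarrow>
     C \<noteq> {} \<and> pre_control_set A \<zeta> \<Omega> C \<and>
     (\<forall>C'. pre_control_set A \<zeta> \<Omega> C' \<and> C \<subseteq> C' \<longrightarrow> C' = C)"

definition is_basis :: "real^2 \<Rightarrow> real^2 \<Rightarrow> bool" where
  "is_basis e1 e2 \<longleftrightarrow> e1 \<noteq> e2 \<and> independent {e1, e2} \<and> span {e1, e2} = UNIV"

(* M is the matrix of the map v \<mapsto> A v in the basis e1, e2: its columns are the
   coordinates of the images of the basis vectors. *)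
definition matrix_in_basis :: "real^2 \<Rightarrow> real^2 \<Rightarrow> real^2^2 \<Rightarrow> real^2^2 \<Rightarrow> bool" where
  "matrix_in_basis e1 e2 A M \<longleftrightarrow>
     A *v e1 = M$1$1 *\<^sub>R e1 + M$2$1 *\<^sub>R e2 \<and>
     A *v e2 = M$1$2 *\<^sub>R e1 + M$2$2 *\<^sub>R e2"

definition in_coords :: "real^2 \<Rightarrow> real^2 \<Rightarrow> (real \<times> real) set \<Rightarrow> (real^2) set" where
  "in_coords e1 e2 S = {x *\<^sub>R e1 + y *\<^sub>R e2 | x y. (x, y) \<in> S}"

end

theory Submission
  imports Defs
begin

text \<open>
  Since \<open>det A = 0\<close> gives \<open>A\<^sup>2 = \<mu> A\<close>, the vectors \<open>e1 = - A \<zeta> / \<mu>\<^sup>2\<close> and \<open>e2 = \<zeta> - A \<zeta> / \<mu>\<close> are eigenvectors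
  and \<open>\<zeta> = - \<mu> e1 + e2\<close>; with this scaling the system reads \<open>x' = \<mu> (x - u)\<close>, \<open>y' = u\<close>, and the
  factor \<open>- \<zeta>1 / \<mu>\<close> of the strip becomes 1. Points of the strip are kept at constant \<open>x\<close> by the
  control \<open>u = x\<close>. If \<open>0\<close> is interior to \<open>\<Omega>\<close>, then waiting at \<open>x = h\<close> and at \<open>x = - h\<close> for suitable
  times adjusts \<open>y\<close> arbitrarily, so the open strip is controllable. Conversely, points outside the
  claimed control set are excluded by continuous functions that never decrease along trajectories but
  strictly increase when leaving the point: a truncated distance to the strip if \<open>\<mu> < 0\<close>, and
  \<open>\<plusminus> (x + \<mu> y)\<close>, whose derivative is \<open>\<plusminus> \<mu> x\<close>, if \<open>\<mu> > 0\<close>. The function \<open>\<plusminus> y\<close> does the same if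
  \<open>0 \<notin> \<Omega>\<close>. If \<open>0\<close> is an endpoint of \<open>\<Omega>\<close>, then \<open>y\<close> is monotone, so mutual approximate reachability forces
  equal \<open>y\<close>, and the variation of \<open>x\<close> is controlled by that of \<open>y\<close>.
\<close>

text \<open>A greatest element of a family is its only maximal element. Uniqueness and the explicit
  form of the control set thus follow together once \<open>T\<close> is admissible and contains
  every admissible set.\<close>

lemma control_set_eq_greatest:
  assumes "pre_control_set A \<zeta> \<Omega> T" and "T \<noteq> {}"
    and "\<And>C. pre_control_set A \<zeta> \<Omega> C \<Longrightarrow> C \<subseteq> T"
  shows "control_set A \<zeta> \<Omega> C \<longleftrightarrow> C = T"
  using assms unfolding control_set_def by blast

subsection \<open>Piecewise constant controls\<close>

lemma locally_finite_real_Un: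
  "locally_finite_real D \<Longrightarrow> locally_finite_real E \<Longrightarrow> locally_finite_real (D \<union> E)"
  by (simp add: locally_finite_real_def Int_Un_distrib2)

lemma locally_finite_real_finite: "finite D \<Longrightarrow> locally_finite_real D"
  by (simp add: locally_finite_real_def)

lemma locally_finite_real_translate:
  assumes "locally_finite_real D"
  shows "locally_finite_real ((+) c ` D)"
  unfolding locally_finite_real_def
proof (intro allI)
  fix a b
  have "(+) c ` D \<inter> {a..b} \<subseteq> (+) c ` (D \<inter> {a - c..b - c})"
    by auto
  then show "finite ((+) c ` D \<inter> {a..b})"
    using assms finite_subset unfolding locally_finite_real_def by blast
qed

lemma locally_finite_real_countable:
  assumes "locally_finite_real D"
  shows "countable D"
proof -
  have "x \<in> (\<Union>n. D \<inter> {- real n..real n})" if "x \<in> D" for x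
    using real_arch_simple[of "\<bar>x\<bar>"] that by (auto simp: abs_le_iff) (metis minus_le_iff)
  then have "D = (\<Union>n. D \<inter> {- real n..real n})"
    by blast
  also have "countable \<dots>"
    using assms by (intro countable_UN) (auto simp: locally_finite_real_def intro: countable_finite)
  finally show ?thesis .
qed

lemma locally_finite_real_isolated:
  assumes "locally_finite_real D" and "s \<notin> D"
  obtains d where "d > 0" and "{s - d<..<s + d} \<inter> D = {}"
proof -
  have "finite (D \<inter> {s - 1..s + 1})"
    using assms by (simp add: locally_finite_real_def)
  then obtain d where d: "d > 0" "\<And>x. x \<in> D \<inter> {s - 1..s + 1} \<Longrightarrow> x \<noteq> s \<Longrightarrow> d \<le> dist s x"
    using finite_set_avoid by metis
  show thesis
  proof
    \<comment> \<open>The avoidance distance \<open>d\<close> was obtained only for points of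
      \<open>D\<close> within distance 1 of \<open>s\<close>, hence the cap.\<close>
    show "min d 1 > 0"
      using d by simp
    show "{s - min d 1<..<s + min d 1} \<inter> D = {}"
      using d(2) assms(2) by (force simp: dist_real_def)
  qed
qed

section \<open>Continuity and primitives off a locally finite set\<close>

lemma constant_off_locally_finite_isCont:
  fixes u :: "real \<Rightarrow> real"
  assumes D: "locally_finite_real D"
    and const: "\<And>I. is_interval I \<Longrightarrow> I \<inter> D = {} \<Longrightarrow> u constant_on I"
    and s: "s \<notin> D"
  shows "isCont u s"
proof -
  obtain d where d: "d > 0" "{s - d<..<s + d} \<inter> D = {}"
    using locally_finite_real_isolated[OF D s] .
  then obtain y where y: "\<And>x. x \<in> {s - d<..<s + d} \<Longrightarrow> u x = y"
    using const[of "{s - d<..<s + d}"] by (auto simp: constant_on_def is_interval_oo)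
  have "continuous_on {s - d<..<s + d} u"
    by (rule continuous_on_eq[OF continuous_on_const[of _ y]]) (simp add: y)
  then show ?thesis
    using d(1) by (simp add: continuous_on_eq_continuous_at)
qed

text \<open>Supplies the integrals in the solution formula. Continuity off a countable set makes
  \<open>g\<close> Borel, local boundedness then makes it integrable on compact intervals, and the
  indefinite integral is differentiable wherever \<open>g\<close> is continuous.\<close>

lemma locally_bounded_primitive:
  fixes g :: "real \<Rightarrow> real"
  assumes D: "locally_finite_real D"
    and cont: "\<And>s. s \<notin> D \<Longrightarrow> isCont g s"
    and bdd: "\<And>a b. \<exists>B. \<forall>s\<in>{a..b}. \<bar>g s\<bar> \<le> B"
  shows "\<exists>F. continuous_on UNIV F \<and> F 0 = 0 \<and> (\<forall>s. s \<notin> D \<longrightarrow> (F has_real_derivative g s) (at s))"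
proof -
  have meas: "g \<in> borel_measurable borel"
    using locally_finite_real_countable[OF D] cont
    by (intro borel_measurable_continuous_countable_exceptions[of D])
       (auto intro!: continuous_at_imp_continuous_on)
  have int: "g integrable_on {a..b}" for a b
  proof -
    obtain B where B: "\<And>s. s \<in> {a..b} \<Longrightarrow> \<bar>g s\<bar> \<le> B"
      using bdd by blast
    have "g \<in> borel_measurable (lebesgue_on {a..b})"
      using meas by (intro measurable_restrict_space1 measurable_completion) simp
    moreover have "(\<lambda>_. B) integrable_on {a..b}"
      by (rule integrable_const_ivl)
    ultimately show ?thesis
      by (rule measurable_bounded_by_integrable_imp_integrable_real) (use B in simp_all)
  qed
  \<comment> \<open>The signed integral from 0 to \<open>t\<close>: one of the two terms always
    vanishes, being over an empty or one-point interval.\<close>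
  define F where "F t = integral {0..t} g - integral {t..0} g" for t
  \<comment> \<open>Moving the base point to some \<open>a\<close> left of both 0 and
    \<open>t\<close> turns \<open>F\<close> into an ordinary indefinite integral up to a
    constant.\<close>
  have F: "F t = integral {a..t} g - integral {a..0} g" if "a \<le> t" "a \<le> 0" for a t
  proof (cases "t \<ge> 0")
    case True
    have "integral {t..0} g = 0"
      using True by (cases "t = 0") auto
    then show ?thesis
      using Henstock_Kurzweil_Integration.integral_combine[of a 0 t g] True that int
      by (simp add: F_def)
  next
    case False
    then show ?thesis
      using Henstock_Kurzweil_Integration.integral_combine[of a t 0 g] that int
      by (simp add: F_def)
  qed
  \<comment> \<open>The base point \<open>min s 0 - 1\<close> lies left of 0 and of a whole
    neighbourhood of \<open>s\<close>, so a single formula describes \<open>F\<close> near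
    \<open>s\<close>.\<close>
  have nbhd: "{min s 0 - 1<..<\<bar>s\<bar> + 1} \<subseteq> {min s 0 - 1..\<bar>s\<bar> + 1}"
    "open {min s 0 - 1<..<\<bar>s\<bar> + 1}" "s \<in> {min s 0 - 1<..<\<bar>s\<bar> + 1}" for s :: real
    by auto
  have F': "F t = integral {min s 0 - 1..t} g - integral {min s 0 - 1..0} g"
    if "t \<in> {min s 0 - 1<..<\<bar>s\<bar> + 1}" for s t
    using that by (intro F) auto
  show ?thesis
  proof (intro exI conjI allI impI)
    show "F 0 = 0"
      by (simp add: F_def)
    have "isCont F s" for s
    proof -
      have "continuous_on {min s 0 - 1<..<\<bar>s\<bar> + 1}
          (\<lambda>t. integral {min s 0 - 1..t} g - integral {min s 0 - 1..0} g)"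
        by (intro continuous_intros continuous_on_subset[OF indefinite_integral_continuous_1 nbhd(1)] int)
      then have "continuous_on {min s 0 - 1<..<\<bar>s\<bar> + 1} F"
        by (rule continuous_on_eq) (simp only: F')
      then show ?thesis
        using nbhd(2,3) by (simp add: continuous_on_eq_continuous_at del: greaterThanLessThan_iff)
    qed
    then show "continuous_on UNIV F"
      by (simp add: continuous_on_eq_continuous_at)
    fix s assume s: "s \<notin> D"
    have "((\<lambda>t. integral {min s 0 - 1..t} g) has_vector_derivative g s)
        (at s within {min s 0 - 1..\<bar>s\<bar> + 1})"
      using integral_has_vector_derivative_continuous_at[OF int, where S = "{}" and x = s
          and a = "min s 0 - 1" and b = "\<bar>s\<bar> + 1"]
        continuous_at_imp_continuous_at_within[OF cont[OF s]] subsetD[OF nbhd(1,3), of s]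
      by simp
    then have "((\<lambda>t. integral {min s 0 - 1..t} g) has_vector_derivative g s)
        (at s within {min s 0 - 1<..<\<bar>s\<bar> + 1})"
      using nbhd(1) has_vector_derivative_within_subset by blast
    then have "((\<lambda>t. integral {min s 0 - 1..t} g) has_vector_derivative g s) (at s)"
      by (simp only: at_within_open[OF nbhd(3,2)])
    then have "((\<lambda>t. integral {min s 0 - 1..t} g - integral {min s 0 - 1..0} g)
        has_real_derivative g s) (at s)"
      by (auto intro!: derivative_eq_intros simp: has_real_derivative_iff_has_vector_derivative)
    then show "(F has_real_derivative g s) (at s)"
      by (rule has_field_derivative_transform_within_open[OF _ nbhd(2,3)]) (simp only: F')
  qed
qed

section \<open>Constant and concatenated controls\<close>

lemma controls_const: "c \<in> \<Omega> \<Longrightarrow> (\<lambda>_. c) \<in> controls \<Omega>"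
  by (auto simp: controls_def piecewise_constant_def constant_on_def
      intro!: exI[of _ "{}"] locally_finite_real_finite)

lemma is_interval_less_or_greater:
  fixes t :: real
  assumes "is_interval I" and "t \<notin> I"
  shows "I \<subseteq> {..<t} \<or> I \<subseteq> {t<..}"
proof (rule ccontr)
  assume "\<not> ?thesis"
  then obtain a b where "a \<in> I" "t \<le> a" "b \<in> I" "b \<le> t"
    by (auto simp: subset_iff not_less)
  then show False
    using assms unfolding is_interval_1 by blast
qed

lemma controls_concat:
  assumes u1: "u1 \<in> controls \<Omega>" and u2: "u2 \<in> controls \<Omega>"
  shows "(\<lambda>s. if s < t then u1 s else u2 (s - t)) \<in> controls \<Omega>" (is "?u \<in> _")
proof -
  obtain D1 where D1: "locally_finite_real D1"
    and c1: "\<And>I. is_interval I \<Longrightarrow> I \<inter> D1 = {} \<Longrightarrow> u1 constant_on I"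
    using u1 by (auto simp: controls_def piecewise_constant_def)
  obtain D2 where D2: "locally_finite_real D2"
    and c2: "\<And>I. is_interval I \<Longrightarrow> I \<inter> D2 = {} \<Longrightarrow> u2 constant_on I"
    using u2 by (auto simp: controls_def piecewise_constant_def)
  \<comment> \<open>With the switching time \<open>t\<close> in the exceptional set, an interval
    avoiding \<open>?D\<close> lies on one side of \<open>t\<close> and sees only one of the two
    controls.\<close>
  let ?D = "insert t (D1 \<union> (+) t ` D2)"
  have "locally_finite_real ({t} \<union> (D1 \<union> (+) t ` D2))"
    by (intro locally_finite_real_Un locally_finite_real_translate D1 D2 locally_finite_real_finite) simp
  moreover have "?u constant_on I" if I: "is_interval I" "I \<inter> ?D = {}" for I
  proof -
    consider "I \<subseteq> {..<t}" | "I \<subseteq> {t<..}"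
      using is_interval_less_or_greater[OF I(1), of t] I(2) by blast
    then show ?thesis
    proof cases
      case 1
      have "u1 constant_on I"
        using I by (intro c1) auto
      then show ?thesis
        using 1 by (fastforce simp: constant_on_def)
    next
      case 2
      have "is_interval ((+) (- t) ` I)"
        using I(1) by simp
      moreover have "(+) (- t) ` I \<inter> D2 = {}"
        using I(2) by force
      ultimately have "u2 constant_on (+) (- t) ` I"
        by (rule c2)
      then show ?thesis
        using 2 by (fastforce simp: constant_on_def)
    qed
  qed
  ultimately have "piecewise_constant ?u"
    unfolding piecewise_constant_def by auto
  then show ?thesis
    using u1 u2 by (auto simp: controls_def)
qed

subsection \<open>Trajectories in eigencoordinates\<close>

text \<open>\<open>X\<close> and \<open>Y\<close> are the coordinate functionals of the eigenbasis;
  they reduce the dynamics to two scalar equations. The normalisation of \<open>\<zeta>\<close>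
  makes a constant control \<open>c\<close> preserve the line where \<open>X\<close> equals
  \<open>c\<close>.\<close>

locale split_planar_system =
  fixes A :: "real^2^2" and \<zeta> e1 e2 :: "real^2" and \<mu> :: real and X Y :: "real^2 \<Rightarrow> real"
    and \<Omega> :: "real set"
  assumes mu_nz: "\<mu> \<noteq> 0"
    and X_linear: "bounded_linear X" and Y_linear: "bounded_linear Y"
    and X_e1 [simp]: "X e1 = 1" and X_e2 [simp]: "X e2 = 0"
    and Y_e1 [simp]: "Y e1 = 0" and Y_e2 [simp]: "Y e2 = 1"
    and decomp: "v = X v *\<^sub>R e1 + Y v *\<^sub>R e2"
    and A_e1: "A *v e1 = \<mu> *\<^sub>R e1" and A_e2: "A *v e2 = 0"
    and zeta: "\<zeta> = (- \<mu>) *\<^sub>R e1 + e2"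
    and bounded_controls: "bounded \<Omega>"
begin

abbreviation sol where "sol u v f \<equiv> is_solution A \<zeta> u v f"

lemma X_simps [simp]: "X 0 = 0" "X (v + w) = X v + X w" "X (c *\<^sub>R v) = c * X v"
  and Y_simps [simp]: "Y 0 = 0" "Y (v + w) = Y v + Y w" "Y (c *\<^sub>R v) = c * Y v"
  using X_linear Y_linear by (simp_all add: linear_simps)

lemma eq_iff_coords: "v = w \<longleftrightarrow> X v = X w \<and> Y v = Y w"
  by (metis decomp)

lemma continuous_X [continuous_intros]: "continuous_on S f \<Longrightarrow> continuous_on S (\<lambda>x. X (f x))"
  and continuous_Y [continuous_intros]: "continuous_on S f \<Longrightarrow> continuous_on S (\<lambda>x. Y (f x))"
  using bounded_linear.continuous_on X_linear Y_linear by blast+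

lemma vector_field:
  "A *v v + c *\<^sub>R \<zeta> = (\<mu> * (X v - c)) *\<^sub>R e1 + c *\<^sub>R e2"
proof -
  have "A *v v = A *v (X v *\<^sub>R e1 + Y v *\<^sub>R e2)"
    by (simp flip: decomp)
  also have "\<dots> = (X v * \<mu>) *\<^sub>R e1"
    by (simp add: matrix_vector_right_distrib matrix_vector_mult_scaleR A_e1 A_e2)
  finally show ?thesis
    by (simp add: zeta algebra_simps)
qed

lemma sol_of_coords:
  assumes cont: "continuous_on UNIV x" "continuous_on UNIV y"
    and D: "locally_finite_real D"
    and dx: "\<And>s. s \<notin> D \<Longrightarrow> (x has_real_derivative \<mu> * (x s - u s)) (at s)"
    and dy: "\<And>s. s \<notin> D \<Longrightarrow> (y has_real_derivative u s) (at s)"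
  shows "sol u (x 0 *\<^sub>R e1 + y 0 *\<^sub>R e2) (\<lambda>s. x s *\<^sub>R e1 + y s *\<^sub>R e2)"
proof -
  have "((\<lambda>s. x s *\<^sub>R e1 + y s *\<^sub>R e2) has_vector_derivative
      A *v (x s *\<^sub>R e1 + y s *\<^sub>R e2) + u s *\<^sub>R \<zeta>) (at s)" if "s \<notin> D" for s
    unfolding vector_field using dx[OF that] dy[OF that]
    by (auto intro!: derivative_eq_intros)
  then show ?thesis
    unfolding is_solution_def using cont D by (auto intro!: continuous_intros)
qed

lemma sol_coord_derivs:
  assumes "sol u v f"
  obtains D where "locally_finite_real D"
    and "\<And>s. s \<notin> D \<Longrightarrow> ((\<lambda>s. X (f s)) has_real_derivative \<mu> * (X (f s) - u s)) (at s)"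
    and "\<And>s. s \<notin> D \<Longrightarrow> ((\<lambda>s. Y (f s)) has_real_derivative u s) (at s)"
proof -
  obtain D where D: "locally_finite_real D"
    and f': "\<And>s. s \<notin> D \<Longrightarrow> (f has_vector_derivative (A *v f s + u s *\<^sub>R \<zeta>)) (at s)"
    using assms by (auto simp: is_solution_def)
  show thesis
    using bounded_linear.has_vector_derivative[OF X_linear f']
      bounded_linear.has_vector_derivative[OF Y_linear f']
    by (intro that[OF D]) (simp_all add: vector_field has_real_derivative_iff_has_vector_derivative)
qed

lemma sol_continuous: "sol u v f \<Longrightarrow> continuous_on S f"
  using continuous_on_subset unfolding is_solution_def by blast

lemma sol_init: "sol u v f \<Longrightarrow> f 0 = v"
  by (simp add: is_solution_def)

text \<open>The fundamental theorem of calculus tolerates the finitely many exceptional times in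
  \<open>{a..b}\<close>. In the third identity the integrating factor
  \<open>exp (- \<mu> * s)\<close> removes \<open>X\<close> from the integrand, leaving only the
  control; the centre \<open>c\<close> stays free for later comparison with the bounds of
  \<open>\<Omega>\<close>.\<close>

lemma sol_integrals:
  assumes f: "sol u v f" and ab: "a \<le> b"
  shows sol_integral_X: "((\<lambda>s. \<mu> * (X (f s) - u s)) has_integral X (f b) - X (f a)) {a..b}"
    and sol_integral_Y: "(u has_integral Y (f b) - Y (f a)) {a..b}"
    and sol_integral_exp: "((\<lambda>s. \<mu> * exp (- \<mu> * s) * (c - u s)) has_integral
      exp (- \<mu> * b) * (X (f b) - c) - exp (- \<mu> * a) * (X (f a) - c)) {a..b}"
proof -
  obtain D where D: "locally_finite_real D"
    and dX: "\<And>s. s \<notin> D \<Longrightarrow> ((\<lambda>s. X (f s)) has_real_derivative \<mu> * (X (f s) - u s)) (at s)"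
    and dY: "\<And>s. s \<notin> D \<Longrightarrow> ((\<lambda>s. Y (f s)) has_real_derivative u s) (at s)"
    using sol_coord_derivs[OF f] by metis
  have ftc: "(g' has_integral g b - g a) {a..b}"
    if "\<And>s. s \<notin> D \<Longrightarrow> (g has_real_derivative g' s) (at s)" "continuous_on {a..b} g" for g g'
    using D ab that
    by (intro fundamental_theorem_of_calculus_strong[of "D \<inter> {a..b}"])
       (auto simp: locally_finite_real_def has_real_derivative_iff_has_vector_derivative)
  have "((\<lambda>s. exp (- \<mu> * s) * (X (f s) - c)) has_real_derivative
      \<mu> * exp (- \<mu> * s) * (c - u s)) (at s)" if "s \<notin> D" for s
    by (auto intro!: derivative_eq_intros dX[OF that] simp: algebra_simps)
  then show "((\<lambda>s. \<mu> * exp (- \<mu> * s) * (c - u s)) has_integral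
      exp (- \<mu> * b) * (X (f b) - c) - exp (- \<mu> * a) * (X (f a) - c)) {a..b}"
    by (intro ftc) (auto intro!: continuous_intros sol_continuous[OF f])
  show "((\<lambda>s. \<mu> * (X (f s) - u s)) has_integral X (f b) - X (f a)) {a..b}"
    by (intro ftc dX) (auto intro!: continuous_intros sol_continuous[OF f])
  show "(u has_integral Y (f b) - Y (f a)) {a..b}"
    by (intro ftc dY) (auto intro!: continuous_intros sol_continuous[OF f])
qed

lemma sol_unique:
  assumes f: "sol u v f" and g: "sol u v g"
  shows "f = g"
proof
  fix t :: real
  \<comment> \<open>The integral identities require ordered endpoints, while \<open>t\<close> may be
    negative. Both integrands depend on \<open>u\<close> alone, which forces the two solutions to
    agree at \<open>t\<close>.\<close>
  define a b where "a = min 0 t" and "b = max 0 t"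
  have ab: "a \<le> b" "a = 0 \<and> b = t \<or> a = t \<and> b = 0"
    by (auto simp: a_def b_def)
  have init: "f 0 = v" "g 0 = v"
    using f g by (auto dest: sol_init)
  have "Y (f t) = Y (g t)"
    using has_integral_unique[OF sol_integral_Y[OF f ab(1)] sol_integral_Y[OF g ab(1)]] ab(2) init
    by auto
  moreover have "X (f t) = X (g t)"
    using has_integral_unique[OF sol_integral_exp[OF f ab(1), of 0] sol_integral_exp[OF g ab(1), of 0]]
      ab(2) init by auto
  ultimately show "f t = g t"
    by (simp add: eq_iff_coords)
qed

lemma sol_phi: "sol u v f \<Longrightarrow> \<phi> A \<zeta> t v u = f t"
  unfolding \<phi>_def by (metis sol_unique the_equality)

lemma sol_exists:
  assumes u: "u \<in> controls \<Omega>"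
  obtains f where "sol u v f"
proof -
  obtain D where D: "locally_finite_real D"
    and const: "\<And>I. is_interval I \<Longrightarrow> I \<inter> D = {} \<Longrightarrow> u constant_on I"
    using u by (auto simp: controls_def piecewise_constant_def)
  have cont: "isCont u s" if "s \<notin> D" for s
    using constant_off_locally_finite_isCont[OF D const that] .
  obtain B where B: "\<And>s. \<bar>u s\<bar> \<le> B"
    using u bounded_controls unfolding controls_def bounded_iff by force
  have "\<exists>C. \<forall>s\<in>{a..b}. \<bar>exp (- \<mu> * s) * u s\<bar> \<le> C" for a b
  proof (intro exI ballI)
    fix s assume s: "s \<in> {a..b}"
    have "- \<mu> * s \<le> \<bar>\<mu>\<bar> * \<bar>s\<bar>"
      by (metis abs_ge_self abs_minus_cancel abs_mult minus_mult_left)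
    also have "\<dots> \<le> \<bar>\<mu>\<bar> * (\<bar>a\<bar> + \<bar>b\<bar>)"
      using s by (intro mult_left_mono) auto
    finally show "\<bar>exp (- \<mu> * s) * u s\<bar> \<le> exp (\<bar>\<mu>\<bar> * (\<bar>a\<bar> + \<bar>b\<bar>)) * B"
      unfolding abs_mult by (intro mult_mono B) auto
  qed
  from locally_bounded_primitive[OF D _ this]
  obtain G where G: "continuous_on UNIV G" "G 0 = 0"
    "\<And>s. s \<notin> D \<Longrightarrow> (G has_real_derivative exp (- \<mu> * s) * u s) (at s)"
    using cont by (auto intro!: continuous_intros)
  have "\<exists>C. \<forall>s\<in>{a..b}. \<bar>u s\<bar> \<le> C" for a b
    using B by blast
  from locally_bounded_primitive[OF D cont this]
  obtain F where F: "continuous_on UNIV F" "F 0 = 0"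
    "\<And>s. s \<notin> D \<Longrightarrow> (F has_real_derivative u s) (at s)"
    by auto
  \<comment> \<open>Variation of constants, \<open>G\<close> being the primitive of
    \<open>exp (- \<mu> * s) * u s\<close>.\<close>
  define x where "x s = exp (\<mu> * s) * (X v - \<mu> * G s)" for s
  define y where "y s = Y v + F s" for s
  have "sol u (x 0 *\<^sub>R e1 + y 0 *\<^sub>R e2) (\<lambda>s. x s *\<^sub>R e1 + y s *\<^sub>R e2)"
  proof (rule sol_of_coords[OF _ _ D])
    show "continuous_on UNIV x" "continuous_on UNIV y"
      unfolding x_def y_def by (intro continuous_intros F G)+
    fix s assume s: "s \<notin> D"
    have "exp (\<mu> * s) * (exp (- \<mu> * s) * u s) = u s"
      by (simp flip: exp_add mult.assoc)
    then show "(x has_real_derivative \<mu> * (x s - u s)) (at s)"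
      unfolding x_def
      by (auto intro!: derivative_eq_intros G(3)[OF s] simp: algebra_simps)
    show "(y has_real_derivative u s) (at s)"
      unfolding y_def by (auto intro!: derivative_eq_intros F(3)[OF s])
  qed
  moreover have "x 0 = X v" "y 0 = Y v"
    using F(2) G(2) by (simp_all add: x_def y_def)
  ultimately show thesis
    using that by (simp flip: decomp)
qed

subsection \<open>Orbits and controllability\<close>

lemma positive_orbitI:
  "sol u v f \<Longrightarrow> u \<in> controls \<Omega> \<Longrightarrow> 0 \<le> t \<Longrightarrow> f t \<in> positive_orbit A \<zeta> \<Omega> v"
  using sol_phi[of u v f t] unfolding positive_orbit_def by (auto intro!: exI[of _ t] exI[of _ u])

lemma positive_orbitE:
  assumes "w \<in> positive_orbit A \<zeta> \<Omega> v"
  obtains u f t where "u \<in> controls \<Omega>" "sol u v f" "0 \<le> t" "w = f t"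
  using assms sol_exists sol_phi unfolding positive_orbit_def by (smt (verit) mem_Collect_eq)

text \<open>The system is autonomous, so a trajectory from \<open>q\<close> delayed by
  \<open>t1\<close> can be glued to one that reaches \<open>q\<close> at time
  \<open>t1\<close>.\<close>

lemma positive_orbit_trans:
  assumes p: "q \<in> positive_orbit A \<zeta> \<Omega> p" and q: "r \<in> positive_orbit A \<zeta> \<Omega> q"
  shows "r \<in> positive_orbit A \<zeta> \<Omega> p"
proof -
  obtain u1 f1 t1 where 1: "u1 \<in> controls \<Omega>" "sol u1 p f1" "0 \<le> t1" "q = f1 t1"
    using p by (rule positive_orbitE)
  obtain u2 f2 t2 where 2: "u2 \<in> controls \<Omega>" "sol u2 q f2" "0 \<le> t2" "r = f2 t2"
    using q by (rule positive_orbitE)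
  obtain D1 where D1: "locally_finite_real D1"
    "\<And>s. s \<notin> D1 \<Longrightarrow> (f1 has_vector_derivative (A *v f1 s + u1 s *\<^sub>R \<zeta>)) (at s)"
    using 1(2) by (auto simp: is_solution_def)
  obtain D2 where D2: "locally_finite_real D2"
    "\<And>s. s \<notin> D2 \<Longrightarrow> (f2 has_vector_derivative (A *v f2 s + u2 s *\<^sub>R \<zeta>)) (at s)"
    using 2(2) by (auto simp: is_solution_def)
  define u where "u s = (if s < t1 then u1 s else u2 (s - t1))" for s
  define f where "f s = (if s \<le> t1 then f1 s else f2 (s - t1))" for s
  define D where "D = {t1} \<union> (D1 \<union> (+) t1 ` D2)"
  have u: "u \<in> controls \<Omega>"
    unfolding u_def using 1(1) 2(1) by (rule controls_concat)
  have D: "locally_finite_real D"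
    unfolding D_def
    by (intro locally_finite_real_Un locally_finite_real_translate D1 D2 locally_finite_real_finite) simp
  have "continuous_on ({..t1} \<union> {t1..}) f"
    unfolding f_def using sol_init[OF 2(2)] 1(4)
    by (intro continuous_on_If continuous_on_compose2[OF sol_continuous[OF 2(2)], where t = UNIV]
        sol_continuous[OF 1(2)] continuous_intros) auto
  moreover have "{..t1} \<union> {t1..} = UNIV"
    by auto
  ultimately have "continuous_on UNIV f"
    by simp
  moreover have "(f has_vector_derivative (A *v f s + u s *\<^sub>R \<zeta>)) (at s)" if s: "s \<notin> D" for s
  proof (cases "s < t1")
    case True
    have "(f1 has_vector_derivative (A *v f s + u s *\<^sub>R \<zeta>)) (at s)"
      using D1(2)[of s] s True by (simp add: f_def u_def D_def)
    then show ?thesis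
      by (rule has_vector_derivative_transform_within_open[where S = "{..<t1}"])
         (use True in \<open>auto simp: f_def\<close>)
  next
    case False
    then have gt: "s > t1"
      using s by (auto simp: D_def)
    have "s - t1 \<notin> D2"
      using s by (force simp: D_def)
    then have "((f2 \<circ> (\<lambda>s. s - t1)) has_vector_derivative
        1 *\<^sub>R (A *v f2 (s - t1) + u2 (s - t1) *\<^sub>R \<zeta>)) (at s)"
      by (intro vector_diff_chain_at D2) (auto intro!: derivative_eq_intros)
    then have "((f2 \<circ> (\<lambda>s. s - t1)) has_vector_derivative (A *v f s + u s *\<^sub>R \<zeta>)) (at s)"
      using gt by (simp add: f_def u_def)
    then show ?thesis
      by (rule has_vector_derivative_transform_within_open[where S = "{t1<..}"])
         (use gt in \<open>auto simp: f_def\<close>)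
  qed
  moreover have "f 0 = p"
    using 1 by (simp add: f_def sol_init)
  ultimately have "sol u p f"
    unfolding is_solution_def using D by blast
  \<comment> \<open>At time \<open>t1\<close> itself \<open>f\<close> takes the \<open>f1\<close>
    branch, so \<open>t2 = 0\<close> is separate; the branches agree there because both equal
    \<open>q\<close>.\<close>
  moreover have "f (t1 + t2) = r"
    using 1 2 by (cases "t2 = 0") (auto simp: f_def sol_init)
  ultimately show ?thesis
    using positive_orbitI[OF _ u, of p f "t1 + t2"] 1(3) 2(3) by simp
qed

section \<open>Steering by constant controls\<close>

lemma sol_const:
  "sol (\<lambda>_. c) v (\<lambda>s. (c + (X v - c) * exp (\<mu> * s)) *\<^sub>R e1 + (Y v + c * s) *\<^sub>R e2)"
proof -
  have "sol (\<lambda>_. c) ((c + (X v - c) * exp (\<mu> * 0)) *\<^sub>R e1 + (Y v + c * 0) *\<^sub>R e2)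
      (\<lambda>s. (c + (X v - c) * exp (\<mu> * s)) *\<^sub>R e1 + (Y v + c * s) *\<^sub>R e2)"
    by (rule sol_of_coords[where D = "{}"])
       (auto intro!: continuous_intros derivative_eq_intros locally_finite_real_finite simp: algebra_simps)
  then show ?thesis
    by (simp flip: decomp)
qed

lemma const_in_positive_orbit:
  assumes "c \<in> \<Omega>" and "0 \<le> t"
  shows "(c + (X v - c) * exp (\<mu> * t)) *\<^sub>R e1 + (Y v + c * t) *\<^sub>R e2 \<in> positive_orbit A \<zeta> \<Omega> v"
  using positive_orbitI[OF sol_const controls_const[OF assms(1)] assms(2)] .

lemma refl_positive_orbit: "\<Omega> \<noteq> {} \<Longrightarrow> v \<in> positive_orbit A \<zeta> \<Omega> v"
  using const_in_positive_orbit[of _ 0 v] by (auto simp flip: decomp)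

text \<open>A constant control \<open>c\<close> multiplies \<open>X - c\<close> by
  \<open>exp (\<mu> * t)\<close>, so \<open>T c\<close> is the time needed to go from
  \<open>x\<close> to \<open>x'\<close>. Since both points lie between \<open>um\<close> and
  \<open>up\<close>, the logarithms for these two controls have opposite signs, and one of the times
  is nonnegative. The shift \<open>d\<close> is independent of \<open>y\<close>, which allows
  transfers to be chained.\<close>

lemma steer_X:
  assumes "{um, up} \<subseteq> \<Omega>" and x: "um < x" "x < up" and x': "um < x'" "x' < up"
  obtains d where "\<And>y. x' *\<^sub>R e1 + (y + d) *\<^sub>R e2 \<in> positive_orbit A \<zeta> \<Omega> (x *\<^sub>R e1 + y *\<^sub>R e2)"
proof -
  define T where "T c = ln ((x' - c) / (x - c)) / \<mu>" for c
  have pos: "(x' - c) / (x - c) > 0" if "c \<in> {um, up}" for c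
    using that x x' by (auto simp: zero_less_divide_iff)
  have "0 \<le> T um \<or> 0 \<le> T up"
  proof (cases "x \<le> x'")
    case True
    then have "ln ((x' - um) / (x - um)) \<ge> 0" "ln ((x' - up) / (x - up)) \<le> 0"
      using x x' pos[of up] by (auto simp: divide_simps)
    then show ?thesis
      using mu_nz by (auto simp: T_def zero_le_divide_iff)
  next
    case False
    then have "ln ((x' - um) / (x - um)) \<le> 0" "ln ((x' - up) / (x - up)) \<ge> 0"
      using x x' pos[of um] by (auto simp: divide_simps)
    then show ?thesis
      using mu_nz by (auto simp: T_def zero_le_divide_iff)
  qed
  then obtain c where c: "c \<in> {um, up}" "0 \<le> T c"
    by blast
  have "(x - c) * exp (\<mu> * T c) = x' - c"
    using pos[OF c(1)] mu_nz by (auto simp: T_def)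
  then show thesis
    using const_in_positive_orbit[OF _ c(2), of c "x *\<^sub>R e1 + _ *\<^sub>R e2"] c(1) assms(1)
    by (intro that[of "c * T c"]) auto
qed

lemma drift_Y:
  assumes "x \<in> \<Omega>" and "0 \<le> t"
  shows "x *\<^sub>R e1 + (y + x * t) *\<^sub>R e2 \<in> positive_orbit A \<zeta> \<Omega> (x *\<^sub>R e1 + y *\<^sub>R e2)"
  using const_in_positive_orbit[OF assms, of "x *\<^sub>R e1 + y *\<^sub>R e2"] by simp

lemma controllable_open_strip:
  assumes Om: "\<Omega> = {um..up}" and "um < 0" "0 < up"
    and p: "um < X p" "X p < up" and q: "um < X q" "X q < up"
  shows "q \<in> positive_orbit A \<zeta> \<Omega> p"
proof -
  \<comment> \<open>Halving puts both \<open>h\<close> and \<open>- h\<close> strictly inside the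
    strip, and makes both admissible as controls.\<close>
  define h where "h = min up (- um) / 2"
  have h: "0 < h" "h < up" "um < h" "- h < up" "um < - h"
    using assms by (auto simp: h_def min_def)
  have sub: "{um, up} \<subseteq> \<Omega>" "h \<in> \<Omega>" "- h \<in> \<Omega>"
    using assms h by auto
  obtain d1 where d1: "\<And>y. h *\<^sub>R e1 + (y + d1) *\<^sub>R e2 \<in> positive_orbit A \<zeta> \<Omega> (X p *\<^sub>R e1 + y *\<^sub>R e2)"
    using steer_X[OF sub(1) p h(3,2)] by metis
  obtain d2 where d2: "\<And>y. (- h) *\<^sub>R e1 + (y + d2) *\<^sub>R e2 \<in> positive_orbit A \<zeta> \<Omega> (h *\<^sub>R e1 + y *\<^sub>R e2)"
    using steer_X[OF sub(1) h(3,2,5,4)] by metis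
  obtain d3 where d3: "\<And>y. X q *\<^sub>R e1 + (y + d3) *\<^sub>R e2 \<in> positive_orbit A \<zeta> \<Omega> ((- h) *\<^sub>R e1 + y *\<^sub>R e2)"
    using steer_X[OF sub(1) h(5,4) q] by metis
  \<comment> \<open>\<open>K\<close> is the signed waiting time that makes up for the
    \<open>Y\<close> shifts of the three transfers: its positive part is spent at \<open>h\<close>,
    its negative part at \<open>- h\<close>.\<close>
  define K where "K = (Y q - Y p - d1 - d2 - d3) / h"
  define y1 where "y1 = Y p + d1 + h * max K 0 + d2 + (- h) * max (- K) 0"
  have "X q *\<^sub>R e1 + (y1 + d3) *\<^sub>R e2 \<in> positive_orbit A \<zeta> \<Omega> (X p *\<^sub>R e1 + Y p *\<^sub>R e2)"
    unfolding y1_def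
    by (rule positive_orbit_trans[OF _ d3] positive_orbit_trans[OF _ d2] positive_orbit_trans[OF _ drift_Y] sub d1
        | simp)+
  moreover have "y1 + d3 = Y q"
  proof -
    have "h * max K 0 + (- h) * max (- K) 0 = h * K"
      by (simp add: max_def)
    also have "\<dots> = Y q - Y p - d1 - d2 - d3"
      using h(1) by (simp add: K_def)
    finally show ?thesis
      by (simp add: y1_def)
  qed
  ultimately show ?thesis
    by (simp flip: decomp)
qed

subsection \<open>Functions monotone along trajectories\<close>

text \<open>Invariance keeps \<open>f 1\<close> in \<open>C\<close>. From there \<open>F\<close>
  stays at least \<open>F (f 1)\<close>, also on the closure of the orbit by continuity, so
  \<open>v\<close> with its smaller value cannot be approached again. The predicate \<open>P\<close>
  limits monotonicity to starting points where it holds; \<open>strict\<close> covers every control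
  because the one keeping the trajectory in \<open>C\<close> is unknown.\<close>

lemma escape:
  assumes C: "pre_control_set A \<zeta> \<Omega> C" and v: "v \<in> C"
    and F: "continuous_on UNIV F"
    and mono: "\<And>p u f t. P p \<Longrightarrow> u \<in> controls \<Omega> \<Longrightarrow> sol u p f \<Longrightarrow> 0 \<le> t \<Longrightarrow> F p \<le> (F (f t) :: real)"
    and strict: "\<And>u f. u \<in> controls \<Omega> \<Longrightarrow> sol u v f \<Longrightarrow> P (f 1) \<and> F v < F (f 1)"
  shows False
proof -
  obtain u where u: "u \<in> controls \<Omega>" "\<And>t. t \<ge> 0 \<Longrightarrow> \<phi> A \<zeta> t v u \<in> C"
    using C v unfolding pre_control_set_def by blast
  obtain f where f: "sol u v f"
    using sol_exists[OF u(1)] .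
  have w: "f 1 \<in> C" "P (f 1)" "F v < F (f 1)"
    using u(2)[of 1] strict[OF u(1) f] by (auto simp: sol_phi[OF f])
  have "positive_orbit A \<zeta> \<Omega> (f 1) \<subseteq> {p. F (f 1) \<le> F p}"
    using mono[OF w(2)] by (auto elim!: positive_orbitE)
  moreover have "closed {p. F (f 1) \<le> F p}"
    using F by (intro closed_Collect_le continuous_on_const)
  ultimately have "closure (positive_orbit A \<zeta> \<Omega> (f 1)) \<subseteq> {p. F (f 1) \<le> F p}"
    by (rule closure_minimal)
  then show False
    using C w(1,3) v unfolding pre_control_set_def by fastforce
qed

text \<open>Integrates \<open>Y' = u\<close>. Here and below the factor \<open>\<sigma>\<close>,
  later 1 or -1, treats upper and lower bounds together.\<close>

lemma Y_growth:
  assumes f: "sol u v f" and t: "0 \<le> t" and c: "\<And>s. c \<le> \<sigma> * u s"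
  shows "\<sigma> * Y v + c * t \<le> \<sigma> * Y (f t)"
proof -
  have "((\<lambda>_. c) has_integral c * t) {0..t}"
    using has_integral_const_real[of c 0 t] t by (simp add: mult.commute)
  moreover have "((\<lambda>s. \<sigma> * u s) has_integral \<sigma> * (Y (f t) - Y (f 0))) {0..t}"
    by (intro has_integral_mult_right sol_integral_Y[OF f t])
  ultimately have "c * t \<le> \<sigma> * (Y (f t) - Y (f 0))"
    using c by (rule has_integral_le)
  then show ?thesis
    using sol_init[OF f] by (simp add: algebra_simps)
qed

text \<open>The weighted deviation \<open>exp (- \<mu> * t) * (\<kappa> * (X (f t) - c))\<close> has
  nonnegative derivative. The factor \<open>\<kappa>\<close> absorbs the sign of
  \<open>\<mu>\<close>: it becomes \<open>\<sigma>\<close> for positive and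
  \<open>- \<sigma>\<close> for negative \<open>\<mu>\<close>.\<close>

lemma X_growth:
  assumes f: "sol u v f" and t: "0 \<le> t" and c: "\<And>s. 0 \<le> \<kappa> * (\<mu> * (c - u s))"
  shows "\<kappa> * (X v - c) \<le> exp (- \<mu> * t) * (\<kappa> * (X (f t) - c))"
proof -
  have "0 \<le> \<kappa> * (exp (- \<mu> * t) * (X (f t) - c) - exp (- \<mu> * 0) * (X (f 0) - c))"
  proof (rule has_integral_nonneg)
    show "((\<lambda>s. \<kappa> * (\<mu> * exp (- \<mu> * s) * (c - u s))) has_integral
        \<kappa> * (exp (- \<mu> * t) * (X (f t) - c) - exp (- \<mu> * 0) * (X (f 0) - c))) {0..t}"
      by (intro has_integral_mult_right sol_integral_exp[OF f t])
    fix s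
    have "\<kappa> * (\<mu> * exp (- \<mu> * s) * (c - u s)) = exp (- \<mu> * s) * (\<kappa> * (\<mu> * (c - u s)))"
      by simp
    also have "\<dots> \<ge> 0"
      by (intro mult_nonneg_nonneg c) simp
    finally show "0 \<le> \<kappa> * (\<mu> * exp (- \<mu> * s) * (c - u s))" .
  qed
  then show ?thesis
    using sol_init[OF f] by (simp add: algebra_simps)
qed

text \<open>The control cancels in the derivative of \<open>X + \<mu> * Y\<close>, which is
  \<open>\<mu> * X\<close>. The half-plane beyond \<open>c\<close> is forward invariant by
  \<open>X_growth\<close>, so this derivative keeps its bound along the whole trajectory.\<close>

lemma X_plus_mu_Y_growth:
  assumes f: "sol u v f" and t: "0 \<le> t" and mu: "0 < \<mu>"
    and c: "\<And>s. \<sigma> * u s \<le> \<sigma> * c" and v: "\<sigma> * c \<le> \<sigma> * X v"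
  shows "\<sigma> * c \<le> \<sigma> * X (f t)"
    and "\<sigma> * (X v + \<mu> * Y v) + \<mu> * (\<sigma> * c) * t \<le> \<sigma> * (X (f t) + \<mu> * Y (f t))"
proof -
  have X: "\<sigma> * c \<le> \<sigma> * X (f s)" if "0 \<le> s" for s
  proof -
    have "0 \<le> \<sigma> * (\<mu> * (c - u r))" for r
      using c[of r] mu by (simp add: algebra_simps)
    then have "\<sigma> * (X v - c) \<le> exp (- \<mu> * s) * (\<sigma> * (X (f s) - c))"
      by (rule X_growth[OF f that])
    moreover have "0 \<le> \<sigma> * (X v - c)"
      using v by (simp add: algebra_simps)
    ultimately have "0 \<le> exp (- \<mu> * s) * (\<sigma> * (X (f s) - c))"
      by linarith
    then have "0 \<le> \<sigma> * (X (f s) - c)"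
      by (simp only: zero_le_mult_iff[of "exp _"]) simp
    then show ?thesis
      by (simp add: algebra_simps)
  qed
  show "\<sigma> * c \<le> \<sigma> * X (f t)"
    using X[OF t] .
  have "((\<lambda>_. \<mu> * (\<sigma> * c)) has_integral \<mu> * (\<sigma> * c) * t) {0..t}"
    using has_integral_const_real[of "\<mu> * (\<sigma> * c)" 0 t] t by (simp add: mult.commute)
  moreover have "((\<lambda>s. \<sigma> * (\<mu> * (X (f s) - u s) + \<mu> * u s)) has_integral
      \<sigma> * (X (f t) - X (f 0) + \<mu> * (Y (f t) - Y (f 0)))) {0..t}"
    by (intro has_integral_mult_right has_integral_add sol_integral_X[OF f t] sol_integral_Y[OF f t])
  moreover have "\<mu> * (\<sigma> * c) \<le> \<sigma> * (\<mu> * (X (f s) - u s) + \<mu> * u s)" if "s \<in> {0..t}" for s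
    using mult_left_mono[OF X, of s \<mu>] that mu by (simp add: algebra_simps)
  ultimately have "\<mu> * (\<sigma> * c) * t \<le> \<sigma> * (X (f t) - X (f 0) + \<mu> * (Y (f t) - Y (f 0)))"
    by (rule has_integral_le)
  then show "\<sigma> * (X v + \<mu> * Y v) + \<mu> * (\<sigma> * c) * t \<le> \<sigma> * (X (f t) + \<mu> * Y (f t))"
    using sol_init[OF f] by (simp add: algebra_simps)
qed

text \<open>A control of constant sign satisfies \<open>\<bar>u s\<bar> = \<sigma> * u s\<close>, so
  its total variation effect on \<open>X\<close> is bounded by its integral, which is the change of
  \<open>Y\<close>.\<close>

lemma X_variation_le_Y_variation:
  assumes f: "sol u v f" and t: "0 \<le> t" and sigma: "\<bar>\<sigma>\<bar> = 1" "\<And>s. 0 \<le> \<sigma> * u s"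
    and E: "\<And>s. s \<in> {0..t} \<Longrightarrow> exp (- \<mu> * s) \<le> E"
  shows "\<bar>exp (- \<mu> * t) * X (f t) - X v\<bar> \<le> \<bar>\<mu>\<bar> * E * (\<sigma> * (Y (f t) - Y v))"
proof -
  have le: "k * (exp (- \<mu> * t) * X (f t) - X v) \<le> \<bar>\<mu>\<bar> * E * (\<sigma> * (Y (f t) - Y v))"
    if k: "\<bar>k\<bar> = 1" for k :: real
  proof (rule has_integral_le)
    show "((\<lambda>s. k * (\<mu> * exp (- \<mu> * s) * (0 - u s))) has_integral
        k * (exp (- \<mu> * t) * X (f t) - X v)) {0..t}"
      using has_integral_mult_right[OF sol_integral_exp[OF f t, of 0], of k] sol_init[OF f] by simp
    show "((\<lambda>s. \<bar>\<mu>\<bar> * E * (\<sigma> * u s)) has_integral \<bar>\<mu>\<bar> * E * (\<sigma> * (Y (f t) - Y v))) {0..t}"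
      using has_integral_mult_right[OF has_integral_mult_right[OF sol_integral_Y[OF f t], of \<sigma>],
          of "\<bar>\<mu>\<bar> * E"] sol_init[OF f] by simp
    fix s assume s: "s \<in> {0..t}"
    have u: "\<bar>u s\<bar> = \<sigma> * u s"
      using sigma(1) sigma(2)[of s] by (metis abs_mult abs_of_nonneg mult_1)
    have "k * (\<mu> * exp (- \<mu> * s) * (0 - u s)) \<le> \<bar>k * (\<mu> * exp (- \<mu> * s) * (0 - u s))\<bar>"
      by (rule abs_ge_self)
    also have "\<dots> = \<bar>\<mu>\<bar> * exp (- \<mu> * s) * \<bar>u s\<bar>"
      using k by (simp add: abs_mult)
    also have "\<dots> \<le> \<bar>\<mu>\<bar> * E * (\<sigma> * u s)"
      unfolding u by (intro mult_right_mono mult_left_mono E s sigma) simp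
    finally show "k * (\<mu> * exp (- \<mu> * s) * (0 - u s)) \<le> \<bar>\<mu>\<bar> * E * (\<sigma> * u s)" .
  qed
  show ?thesis
    using le[of 1] le[of "- 1"] by (simp add: abs_le_iff)
qed

section \<open>Restrictions on sets with the first two control set properties\<close>

lemma not_pre_control_set_if_signed:
  assumes "\<And>w. w \<in> \<Omega> \<Longrightarrow> c \<le> \<sigma> * w" and "0 < c"
    and C: "pre_control_set A \<zeta> \<Omega> C"
  shows "C = {}"
proof (rule ccontr)
  assume "C \<noteq> {}"
  then obtain v where v: "v \<in> C"
    by blast
  have growth: "\<sigma> * Y p + c * t \<le> \<sigma> * Y (f t)" if "u \<in> controls \<Omega>" "sol u p f" "0 \<le> t" for u p f t
    using that assms(1) by (intro Y_growth) (auto simp: controls_def)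
  show False
  proof (rule escape[OF C v, where F = "\<lambda>p. \<sigma> * Y p" and P = "\<lambda>_. True"])
    show "continuous_on UNIV (\<lambda>p. \<sigma> * Y p)"
      by (intro continuous_intros)
    show "\<sigma> * Y p \<le> \<sigma> * Y (f t)" if "u \<in> controls \<Omega>" "sol u p f" "0 \<le> t" for u p f t
      using growth[OF that] mult_nonneg_nonneg[of c t] assms(2) that(3) by linarith
    show "True \<and> \<sigma> * Y v < \<sigma> * Y (f 1)" if "u \<in> controls \<Omega>" "sol u v f" for u f
      using growth[OF that, of 1] assms(2) by simp
  qed
qed

text \<open>For negative \<open>\<mu>\<close> a positive excess \<open>\<sigma> * (X - c)\<close>
  shrinks at least by the factor \<open>exp (\<mu> * t)\<close>, so no trajectory returns near a
  point outside the closed half-plane.\<close>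

lemma pre_control_set_bound_stable:
  assumes mu: "\<mu> < 0" and Om: "\<And>w. w \<in> \<Omega> \<Longrightarrow> \<sigma> * w \<le> \<sigma> * c"
    and C: "pre_control_set A \<zeta> \<Omega> C" and v: "v \<in> C"
  shows "\<sigma> * X v \<le> \<sigma> * c"
proof (rule ccontr)
  assume gt: "\<not> ?thesis"
  have decay: "exp (- \<mu> * t) * (\<sigma> * (X (f t) - c)) \<le> \<sigma> * (X p - c)"
    if "u \<in> controls \<Omega>" "sol u p f" "0 \<le> t" for u p f t
  proof -
    have "0 \<le> - \<sigma> * (\<mu> * (c - u s))" for s
    proof -
      have "0 \<le> (- \<mu>) * (\<sigma> * c - \<sigma> * u s)"
        using mu Om[of "u s"] that(1) by (intro mult_nonneg_nonneg) (auto simp: controls_def)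
      then show ?thesis
        by (simp add: algebra_simps)
    qed
    from X_growth[OF that(2,3) this] show ?thesis
      by simp
  qed
  have step: "r \<le> s \<or> r \<le> 0" "r < s \<or> r \<le> 0 \<or> t = 0"
    if "exp (- \<mu> * t) * r \<le> s" "0 \<le> t" for r s t
  proof -
    have "r \<le> exp (- \<mu> * t) * r" if "0 < r"
      using mu that \<open>0 \<le> t\<close> by (simp add: mult_nonneg_nonpos2 mult_nonpos_nonneg)
    then show "r \<le> s \<or> r \<le> 0"
      using that by linarith
    have "r < exp (- \<mu> * t) * r" if "0 < r" "t \<noteq> 0"
      using mu that \<open>0 \<le> t\<close> by (simp add: mult_neg_pos)
    then show "r < s \<or> r \<le> 0 \<or> t = 0"
      using that by linarith
  qed
  show False
  \<comment> \<open>The excess is truncated at 0 because a negative excess may increase towards 0;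
    after truncation the function is monotone everywhere.\<close>
  proof (rule escape[OF C v, where F = "\<lambda>p. - max (\<sigma> * (X p - c)) 0" and P = "\<lambda>_. True"])
    show "continuous_on UNIV (\<lambda>p. - max (\<sigma> * (X p - c)) 0)"
      by (intro continuous_intros)
    show "- max (\<sigma> * (X p - c)) 0 \<le> - max (\<sigma> * (X (f t) - c)) 0"
      if "u \<in> controls \<Omega>" "sol u p f" "0 \<le> t" for u p f t
      using step(1)[OF decay[OF that] that(3)] by linarith
    show "True \<and> - max (\<sigma> * (X v - c)) 0 < - max (\<sigma> * (X (f 1) - c)) 0"
      if "u \<in> controls \<Omega>" "sol u v f" for u f
    proof -
      have "0 < \<sigma> * (X v - c)"
        using gt by (simp add: algebra_simps)
      then show ?thesis
        using step(2)[OF decay[OF that, of 1]] by simp linarith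
    qed
  qed
qed

text \<open>On the half-plane \<open>\<sigma> * c \<le> \<sigma> * X\<close>, which trajectories do
  not leave, \<open>\<sigma> * (X + \<mu> * Y)\<close> grows at rate at least
  \<open>\<mu> * (\<sigma> * c) > 0\<close>. This includes the boundary line, hence the strict
  inequality.\<close>

lemma pre_control_set_bound_unstable:
  assumes mu: "0 < \<mu>" and Om: "\<And>w. w \<in> \<Omega> \<Longrightarrow> \<sigma> * w \<le> \<sigma> * c" and c: "0 < \<sigma> * c"
    and C: "pre_control_set A \<zeta> \<Omega> C" and v: "v \<in> C"
  shows "\<sigma> * X v < \<sigma> * c"
proof (rule ccontr)
  assume ge: "\<not> ?thesis"
  have u: "\<sigma> * u s \<le> \<sigma> * c" if "u \<in> controls \<Omega>" for u s
    using that Om by (auto simp: controls_def)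
  note growth = X_plus_mu_Y_growth[OF _ _ mu u]
  show False
  proof (rule escape[OF C v, where F = "\<lambda>p. \<sigma> * (X p + \<mu> * Y p)" and P = "\<lambda>p. \<sigma> * c \<le> \<sigma> * X p"])
    show "continuous_on UNIV (\<lambda>p. \<sigma> * (X p + \<mu> * Y p))"
      by (intro continuous_intros)
    show "\<sigma> * (X p + \<mu> * Y p) \<le> \<sigma> * (X (f t) + \<mu> * Y (f t))"
      if "\<sigma> * c \<le> \<sigma> * X p" "u \<in> controls \<Omega>" "sol u p f" "0 \<le> t" for u p f t
      using growth(2)[OF that(3,4,2,1)]
        mult_nonneg_nonneg[OF less_imp_le[OF mult_pos_pos[OF mu c]] that(4)] by linarith
    show "\<sigma> * c \<le> \<sigma> * X (f 1) \<and> \<sigma> * (X v + \<mu> * Y v) < \<sigma> * (X (f 1) + \<mu> * Y (f 1))"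
      if "u \<in> controls \<Omega>" "sol u v f" for u f
      using growth[OF that(2) _ that(1), of 1] mult_pos_pos[OF mu c] ge by simp
  qed
qed

subsection \<open>The control sets\<close>

lemma control_set_singleton:
  assumes zero: "0 \<in> \<Omega>" and sigma: "\<bar>\<sigma>\<bar> = 1" "\<And>w. w \<in> \<Omega> \<Longrightarrow> 0 \<le> \<sigma> * w"
  shows "control_set A \<zeta> \<Omega> {\<alpha> *\<^sub>R e2}"
proof -
  let ?p = "\<alpha> *\<^sub>R e2"
  have stay: "sol (\<lambda>_. 0) ?p (\<lambda>_. ?p)"
    using sol_const[of 0 ?p] by simp
  have pre: "pre_control_set A \<zeta> \<Omega> {?p}"
  proof -
    have "?p \<in> closure (positive_orbit A \<zeta> \<Omega> ?p)"
      using refl_positive_orbit closure_subset zero by blast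
    moreover have "\<exists>u\<in>controls \<Omega>. \<forall>t\<ge>0. \<phi> A \<zeta> t ?p u \<in> {?p}"
      using controls_const[OF zero] sol_phi[OF stay] by (intro bexI[of _ "\<lambda>_. 0"]) simp_all
    ultimately show ?thesis
      by (simp add: pre_control_set_def)
  qed
  have u: "0 \<le> \<sigma> * u s" if "u \<in> controls \<Omega>" for u s
    using that sigma(2) by (auto simp: controls_def)
  have Y: "closure (positive_orbit A \<zeta> \<Omega> v) \<subseteq> {w. \<sigma> * Y v \<le> \<sigma> * Y w}" for v
  proof (rule closure_minimal)
    show "closed {w. \<sigma> * Y v \<le> \<sigma> * Y w}"
      by (intro closed_Collect_le continuous_intros)
    show "positive_orbit A \<zeta> \<Omega> v \<subseteq> {w. \<sigma> * Y v \<le> \<sigma> * Y w}"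
      using Y_growth[where c = 0] u by (auto elim!: positive_orbitE)
  qed
  have "w = ?p" if C: "pre_control_set A \<zeta> \<Omega> C" "?p \<in> C" and w: "w \<in> C" for C w
  proof -
    have pw: "w \<in> closure (positive_orbit A \<zeta> \<Omega> ?p)" and wp: "?p \<in> closure (positive_orbit A \<zeta> \<Omega> w)"
      using C w unfolding pre_control_set_def by blast+
    have "\<sigma> * Y w = \<sigma> * \<alpha>"
      using subsetD[OF Y pw] subsetD[OF Y wp] by simp
    then have Yw: "Y w = \<alpha>"
      using sigma(1) by auto
    have "X w = 0"
    proof (cases "\<mu> < 0")
      case True
      \<comment> \<open>For negative \<open>\<mu>\<close> the weights are at most
        \<open>exp (- \<mu> * t)\<close>, so a trajectory starting at \<open>?p\<close>, where
        \<open>X\<close> is 0, has a bound free of \<open>t\<close> after division. At its limit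
        point \<open>w\<close> the right-hand side vanishes.\<close>
      have "closure (positive_orbit A \<zeta> \<Omega> ?p) \<subseteq> {q. \<bar>X q\<bar> \<le> \<bar>\<mu>\<bar> * (\<sigma> * (Y q - \<alpha>))}"
      proof (rule closure_minimal)
        show "closed {q. \<bar>X q\<bar> \<le> \<bar>\<mu>\<bar> * (\<sigma> * (Y q - \<alpha>))}"
          by (intro closed_Collect_le continuous_intros)
        have "\<bar>X (f t)\<bar> \<le> \<bar>\<mu>\<bar> * (\<sigma> * (Y (f t) - \<alpha>))"
          if "u \<in> controls \<Omega>" "sol u ?p f" "0 \<le> t" for u f t
        proof -
          have "exp (- \<mu> * s) \<le> exp (- \<mu> * t)" if "s \<in> {0..t}" for s
            using that True by simp
          from X_variation_le_Y_variation[OF that(2,3) sigma(1) u[OF that(1)] this]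
          have "exp (- \<mu> * t) * \<bar>X (f t)\<bar> \<le> exp (- \<mu> * t) * (\<bar>\<mu>\<bar> * (\<sigma> * (Y (f t) - \<alpha>)))"
            by (simp add: abs_mult mult_ac)
          then show ?thesis
            by simp
        qed
        then show "positive_orbit A \<zeta> \<Omega> ?p \<subseteq> {q. \<bar>X q\<bar> \<le> \<bar>\<mu>\<bar> * (\<sigma> * (Y q - \<alpha>))}"
          by (auto elim!: positive_orbitE)
      qed
      then show ?thesis
        using pw Yw by auto
    next
      case False
      \<comment> \<open>Otherwise the weights are at most 1, and the bound free of \<open>t\<close>
        comes from starting at \<open>w\<close> instead. At the limit point \<open>?p\<close> both
        terms on the right vanish.\<close>
      have "closure (positive_orbit A \<zeta> \<Omega> w) \<subseteq> {q. \<bar>X w\<bar> \<le> \<bar>X q\<bar> + \<bar>\<mu>\<bar> * (\<sigma> * (Y q - Y w))}"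
      proof (rule closure_minimal)
        show "closed {q. \<bar>X w\<bar> \<le> \<bar>X q\<bar> + \<bar>\<mu>\<bar> * (\<sigma> * (Y q - Y w))}"
          by (intro closed_Collect_le continuous_intros)
        have "\<bar>X w\<bar> \<le> \<bar>X (f t)\<bar> + \<bar>\<mu>\<bar> * (\<sigma> * (Y (f t) - Y w))"
          if "u \<in> controls \<Omega>" "sol u w f" "0 \<le> t" for u f t
        proof -
          have "exp (- \<mu> * s) \<le> 1" if "s \<in> {0..t}" for s
            using that False by simp
          from X_variation_le_Y_variation[OF that(2,3) sigma(1) u[OF that(1)] this]
          have "\<bar>exp (- \<mu> * t) * X (f t) - X w\<bar> \<le> \<bar>\<mu>\<bar> * (\<sigma> * (Y (f t) - Y w))"
            by simp
          moreover have "\<bar>exp (- \<mu> * t) * X (f t)\<bar> \<le> \<bar>X (f t)\<bar>"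
            using False that(3) by (simp add: abs_mult mult_left_le_one_le)
          ultimately show ?thesis
            by linarith
        qed
        then show "positive_orbit A \<zeta> \<Omega> w \<subseteq> {q. \<bar>X w\<bar> \<le> \<bar>X q\<bar> + \<bar>\<mu>\<bar> * (\<sigma> * (Y q - Y w))}"
          by (auto elim!: positive_orbitE)
      qed
      then show ?thesis
        using wp Yw by auto
    qed
    then show ?thesis
      using Yw by (simp add: eq_iff_coords)
  qed
  then show ?thesis
    using pre unfolding control_set_def by blast
qed

text \<open>The bounds with \<open>\<sigma>\<close> equal to 1 and -1 confine every admissible set
  to the strip. The strip is itself admissible: each of its points reaches the whole open strip,
  whose closure contains it.\<close>

lemma control_set_strip:
  assumes Om: "\<Omega> = {um..up}" and signs: "um < 0" "0 < up"
  shows "control_set A \<zeta> \<Omega> C \<longleftrightarrow> C = {v. X v \<in> (if \<mu> < 0 then {um..up} else {um<..<up})}"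
    (is "_ \<longleftrightarrow> _ = ?T")
proof (rule control_set_eq_greatest)
  have "0 \<in> ?T"
    using signs by simp
  then show "?T \<noteq> {}"
    by blast
  show "C \<subseteq> ?T" if C: "pre_control_set A \<zeta> \<Omega> C" for C
  proof
    fix v assume v: "v \<in> C"
    show "v \<in> ?T"
    proof (cases "\<mu> < 0")
      case True
      have "1 * X v \<le> 1 * up"
        using Om by (intro pre_control_set_bound_stable[OF True _ C v]) simp
      moreover have "(- 1) * X v \<le> (- 1) * um"
        using Om by (intro pre_control_set_bound_stable[OF True _ C v]) simp
      ultimately show ?thesis
        using True by simp
    next
      case False
      then have mu: "0 < \<mu>"
        using mu_nz by simp
      have "1 * X v < 1 * up"
        using Om signs by (intro pre_control_set_bound_unstable[OF mu _ _ C v]) simp_all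
      moreover have "(- 1) * X v < (- 1) * um"
        using Om signs by (intro pre_control_set_bound_unstable[OF mu _ _ C v]) simp_all
      ultimately show ?thesis
        using False by simp
    qed
  qed
  have inv: "\<exists>u\<in>controls \<Omega>. \<forall>t\<ge>0. \<phi> A \<zeta> t v u \<in> ?T" if "v \<in> ?T" for v
  proof (intro bexI allI impI)
    show "(\<lambda>_. X v) \<in> controls \<Omega>"
      using that Om by (intro controls_const) (auto split: if_splits)
    show "\<phi> A \<zeta> t v (\<lambda>_. X v) \<in> ?T" for t
      using that by (simp add: sol_phi[OF sol_const])
  qed
  have open_strip: "{w. X w \<in> {um<..<up}} \<subseteq> positive_orbit A \<zeta> \<Omega> v" if v: "v \<in> ?T" for v
  proof (cases "\<mu> < 0")
    case False
    then show ?thesis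
      using v controllable_open_strip[OF Om signs] by auto
  next
    case True
    \<comment> \<open>A boundary point of the closed strip enters the open one under the zero
      control, which contracts \<open>X\<close> towards 0; time 1 suffices.\<close>
    define p where "p = (X v * exp \<mu>) *\<^sub>R e1 + Y v *\<^sub>R e2"
    have "p \<in> positive_orbit A \<zeta> \<Omega> v"
      using const_in_positive_orbit[of 0 1 v] Om signs by (simp add: p_def)
    moreover have "um < X p" "X p < up"
    proof -
      have e: "0 < exp \<mu>" "exp \<mu> < 1"
        using True by auto
      have "X v * exp \<mu> \<le> up * exp \<mu>" "um * exp \<mu> \<le> X v * exp \<mu>"
        using v True by (auto intro!: mult_right_mono)
      moreover have "up * exp \<mu> < up * 1" "um * 1 < um * exp \<mu>"
        using e signs by (simp_all only: mult_less_cancel_left_pos mult_less_cancel_left_neg)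
      ultimately have "um < X v * exp \<mu>" "X v * exp \<mu> < up"
        by linarith+
      then show "um < X p" "X p < up"
        by (simp_all add: p_def)
    qed
    ultimately show ?thesis
      using positive_orbit_trans[OF _ controllable_open_strip[OF Om signs]] by auto
  qed
  have "?T \<subseteq> closure {w. X w \<in> {um<..<up}}"
  proof
    fix q assume q: "q \<in> ?T"
    \<comment> \<open>Scaling \<open>q\<close> towards the origin, an interior point of the strip,
      moves it strictly inside; the factors tend to 1.\<close>
    define r where "r n = 1 - inverse (real (Suc n))" for n
    have r: "0 \<le> r n" "r n < 1" for n
      by (auto simp: r_def divide_simps)
    have "X (r n *\<^sub>R q) \<in> {um<..<up}" for n
    proof -
      have "r n * X q \<le> r n * up" "r n * um \<le> r n * X q"
        using q r[of n] by (auto intro!: mult_left_mono split: if_splits)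
      moreover have "r n * up < 1 * up" "1 * um < r n * um"
        using r[of n] signs by (simp_all only: mult_less_cancel_right_pos mult_less_cancel_right_neg)
      ultimately show ?thesis
        by simp
    qed
    moreover have "(\<lambda>n. r n *\<^sub>R q) \<longlonglongrightarrow> (1 - 0) *\<^sub>R q"
      unfolding r_def by (intro tendsto_intros LIMSEQ_inverse_real_of_nat)
    ultimately show "q \<in> closure {w. X w \<in> {um<..<up}}"
      unfolding closure_sequential by (intro exI[of _ "\<lambda>n. r n *\<^sub>R q"]) simp
  qed
  then show "pre_control_set A \<zeta> \<Omega> ?T"
    unfolding pre_control_set_def using inv closure_mono[OF open_strip] by blast
qed

lemma basis: "is_basis e1 e2"
  unfolding is_basis_def
proof (intro conjI)
  show "e1 \<noteq> e2"
    using X_e1 X_e2 by force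
  have "e2 \<noteq> 0"
    using Y_e2 Y_simps(1) zero_neq_one by metis
  moreover have "e1 \<notin> span {e2}"
  proof
    assume "e1 \<in> span {e2}"
    then obtain k where "e1 = k *\<^sub>R e2"
      by (auto simp: span_singleton)
    then have "X e1 = X (k *\<^sub>R e2)"
      by (rule arg_cong)
    then show False
      by simp
  qed
  ultimately show "independent {e1, e2}"
    using \<open>e1 \<noteq> e2\<close> by (simp add: independent_insert)
  have "v \<in> span {e1, e2}" for v
    by (subst decomp[of v]) (intro span_add span_scale span_base; simp)
  then show "span {e1, e2} = UNIV"
    by blast
qed

lemma in_coords_strip: "in_coords e1 e2 (S \<times> UNIV) = {v. X v \<in> S}"
proof -
  have "\<exists>x y. v = x *\<^sub>R e1 + y *\<^sub>R e2 \<and> x \<in> S" if "X v \<in> S" for v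
    using that decomp by blast
  then show ?thesis
    by (auto simp: in_coords_def)
qed

end

subsection \<open>Choice of the basis\<close>

text \<open>The Cayley-Hamilton identity with vanishing determinant.\<close>

lemma singular_matrix_square:
  fixes A :: "real^2^2"
  assumes "det A = 0"
  shows "A *v (A *v v) = trace A *\<^sub>R (A *v v)"
proof -
  have d: "A$1$1 * A$2$2 = A$1$2 * A$2$1"
    using assms by (simp add: det_2)
  have "(A *v (A *v v)) $ 1 = (trace A *\<^sub>R (A *v v)) $ 1"
    using d by (simp add: matrix_vector_mult_def sum_2 trace_def) algebra
  moreover have "(A *v (A *v v)) $ 2 = (trace A *\<^sub>R (A *v v)) $ 2"
    using d by (simp add: matrix_vector_mult_def sum_2 trace_def) algebra
  ultimately show ?thesis
    by (simp add: vec_eq_iff forall_2)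
qed

text \<open>Up to sign this is the determinant with columns \<open>v\<close> and \<open>w\<close>,
  so the LARC says that \<open>A *v \<zeta>\<close> and \<open>\<zeta>\<close> are linearly
  independent.\<close>

lemma inner_theta: "(v :: real^2) \<bullet> (\<theta> *v w) = v$2 * w$1 - v$1 * w$2"
  by (simp add: inner_vec_def \<theta>_def matrix_vector_mult_def sum_2)

lemma split_planar_system_normal_form:
  assumes larc: "LARC A \<zeta>" and det: "det A = 0" and tr: "trace A \<noteq> 0" and Om: "bounded \<Omega>"
  obtains e1 e2 X Y where "split_planar_system A \<zeta> e1 e2 (trace A) X Y \<Omega>"
proof -
  let ?mu = "trace A" and ?a = "A *v \<zeta>"
  define k where "k = ?a \<bullet> (\<theta> *v \<zeta>)"
  have k: "k \<noteq> 0"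
    using larc by (simp add: LARC_def k_def)
  \<comment> \<open>By Cramer's rule \<open>P\<close> and \<open>Q\<close> are the coordinates with
    respect to \<open>A *v \<zeta>\<close> and \<open>\<zeta>\<close>; \<open>k\<close> is the
    nonzero determinant.\<close>
  define P where "P v = v \<bullet> (\<theta> *v \<zeta>) / k" for v :: "real^2"
  define Q where "Q v = - (v \<bullet> (\<theta> *v ?a)) / k" for v :: "real^2"
  let ?e1 = "(- 1 / ?mu\<^sup>2) *\<^sub>R ?a" and ?e2 = "\<zeta> - (1 / ?mu) *\<^sub>R ?a"
  \<comment> \<open>Obtained by substituting
    \<open>A *v \<zeta> = - ?mu\<^sup>2 *\<^sub>R ?e1\<close> and
    \<open>\<zeta> = - ?mu *\<^sub>R ?e1 + ?e2\<close> into the decomposition by \<open>P\<close>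
    and \<open>Q\<close>; the coordinate along \<open>?e2\<close> is \<open>Q\<close>
    itself.\<close>
  define X where "X v = - ?mu\<^sup>2 * P v - ?mu * Q v" for v
  have lin: "bounded_linear P" "bounded_linear Q"
    unfolding P_def Q_def
    by (intro bounded_linear_divide bounded_linear_minus bounded_linear_inner_left
        bounded_linear_compose[OF bounded_linear_divide])+
  have vals: "P ?a = 1" "P \<zeta> = 0" "Q ?a = 0" "Q \<zeta> = 1"
    using k by (simp_all add: P_def Q_def k_def inner_theta)
  have dec: "v = P v *\<^sub>R ?a + Q v *\<^sub>R \<zeta>" for v
  proof -
    have "k *\<^sub>R v = (v \<bullet> (\<theta> *v \<zeta>)) *\<^sub>R ?a - (v \<bullet> (\<theta> *v ?a)) *\<^sub>R \<zeta>"
      by (simp add: vec_eq_iff forall_2 k_def inner_theta algebra_simps)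
    then have "v = (1 / k) *\<^sub>R ((v \<bullet> (\<theta> *v \<zeta>)) *\<^sub>R ?a - (v \<bullet> (\<theta> *v ?a)) *\<^sub>R \<zeta>)"
      using k by (metis divide_self_if scaleR_one scaleR_scaleR times_divide_eq_left mult_1)
    then show ?thesis
      by (simp add: P_def Q_def scaleR_diff_right)
  qed
  have "split_planar_system A \<zeta> ?e1 ?e2 ?mu X Q \<Omega>"
  proof (rule split_planar_system.intro)
    show "?mu \<noteq> 0" "bounded \<Omega>"
      by fact+
    show "bounded_linear X" "bounded_linear Q"
      unfolding X_def
      by (intro bounded_linear_sub bounded_linear_const_mult lin)+
    show "X ?e1 = 1" "X ?e2 = 0" "Q ?e1 = 0" "Q ?e2 = 1"
      using tr vals lin by (simp_all add: X_def linear_simps power2_eq_square)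
    show "v = X v *\<^sub>R ?e1 + Q v *\<^sub>R ?e2" for v
    proof -
      have "X v *\<^sub>R ?e1 + Q v *\<^sub>R ?e2 = (- X v / ?mu\<^sup>2 - Q v / ?mu) *\<^sub>R ?a + Q v *\<^sub>R \<zeta>"
        by (simp add: algebra_simps)
      also have "- X v / ?mu\<^sup>2 - Q v / ?mu = P v"
        using tr by (simp add: X_def field_simps power2_eq_square)
      finally show ?thesis
        using dec[of v] by simp
    qed
    show "A *v ?e1 = ?mu *\<^sub>R ?e1"
      by (simp only: matrix_vector_mult_scaleR singular_matrix_square[OF det] scaleR_scaleR mult.commute)
    show "A *v ?e2 = 0"
      using tr by (simp add: matrix_vector_mult_diff_distrib matrix_vector_mult_scaleR singular_matrix_square[OF det])
    show "\<zeta> = (- ?mu) *\<^sub>R ?e1 + ?e2"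
      using tr by (simp add: power2_eq_square)
  qed
  then show thesis
    by (rule that)
qed

theorem theorem3p3:
  fixes A :: "real^2^2" and \<zeta> :: "real^2" and um up :: real and \<Omega> :: "real set"
  assumes zeta_nz: "\<zeta> \<noteq> 0"
    and um_less_up: "um < up"
    and Omega: "\<Omega> = {um..up}"
    and larc: "LARC A \<zeta>"
    and det_zero: "det A = 0"
    and trace_nz: "trace A \<noteq> 0"
  shows "\<exists>e1 e2 \<mu> \<zeta>1 \<zeta>2.
    is_basis e1 e2 \<and>
    \<mu> = trace A \<and> \<mu> \<noteq> 0 \<and>
    matrix_in_basis e1 e2 A (vector [vector [\<mu>, 0], vector [0, 0]]) \<and>
    \<zeta> = \<zeta>1 *\<^sub>R e1 + \<zeta>2 *\<^sub>R e2 \<and>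
    (0 \<in> interior \<Omega> \<longrightarrow>
       (\<exists>!C. control_set A \<zeta> \<Omega> C) \<and>
       (\<forall>C. control_set A \<zeta> \<Omega> C \<longrightarrow>
          (\<mu> < 0 \<longrightarrow> C = in_coords e1 e2 ((\<lambda>s. - (\<zeta>1 / \<mu>) * s) ` \<Omega> \<times> UNIV)) \<and>
          (\<mu> > 0 \<longrightarrow> C = in_coords e1 e2 ((\<lambda>s. - (\<zeta>1 / \<mu>) * s) ` interior \<Omega> \<times> UNIV)))) \<and>
    (0 \<in> frontier \<Omega> \<longrightarrow> (\<forall>\<alpha>. control_set A \<zeta> \<Omega> {\<alpha> *\<^sub>R e2})) \<and>
    (0 \<notin> \<Omega> \<longrightarrow> \<not> (\<exists>C. control_set A \<zeta> \<Omega> C))"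
proof -
  have bdd: "bounded \<Omega>"
    by (simp add: Omega)
  obtain e1 e2 X Y where sys: "split_planar_system A \<zeta> e1 e2 (trace A) X Y \<Omega>"
    using split_planar_system_normal_form[OF larc det_zero trace_nz bdd] .
  interpret split_planar_system A \<zeta> e1 e2 "trace A" X Y \<Omega>
    by (rule sys)
  have interior: "interior \<Omega> = {um<..<up}"
    by (simp add: Omega)
  have scale: "(\<lambda>s. - ((- trace A) / trace A) * s) ` S = S" for S :: "real set"
    using trace_nz by simp
  show ?thesis
  proof (rule exI[of _ e1], rule exI[of _ e2], rule exI[of _ "trace A"], rule exI[of _ "- trace A"],
      rule exI[of _ 1], intro conjI impI)
    show "is_basis e1 e2"
      by (rule basis)
    show "trace A = trace A" "trace A \<noteq> 0"
      by (simp_all add: trace_nz)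
    show "matrix_in_basis e1 e2 A (vector [vector [trace A, 0], vector [0, 0]])"
      by (simp add: matrix_in_basis_def A_e1 A_e2)
    show "\<zeta> = (- trace A) *\<^sub>R e1 + 1 *\<^sub>R e2"
      using zeta by simp
  next
    assume "0 \<in> interior \<Omega>"
    then have signs: "um < 0" "0 < up"
      by (simp_all add: interior)
    note eq = control_set_strip[OF Omega signs]
    show "\<exists>!C. control_set A \<zeta> \<Omega> C"
      unfolding eq by simp
    show "\<forall>C. control_set A \<zeta> \<Omega> C \<longrightarrow>
        (trace A < 0 \<longrightarrow>
          C = in_coords e1 e2 ((\<lambda>s. - ((- trace A) / trace A) * s) ` \<Omega> \<times> UNIV)) \<and>
        (trace A > 0 \<longrightarrow>
          C = in_coords e1 e2 ((\<lambda>s. - ((- trace A) / trace A) * s) ` interior \<Omega> \<times> UNIV))"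
      unfolding eq scale in_coords_strip interior by (auto simp: Omega)
  next
    assume "0 \<in> frontier \<Omega>"
    then have "um = 0 \<or> up = 0"
      using um_less_up by (auto simp: frontier_def Omega)
    then show "\<forall>\<alpha>. control_set A \<zeta> \<Omega> {\<alpha> *\<^sub>R e2}"
    proof
      assume "um = 0"
      then show ?thesis
        using um_less_up by (intro allI control_set_singleton[where \<sigma> = 1]) (simp_all add: Omega)
    next
      assume "up = 0"
      then show ?thesis
        using um_less_up by (intro allI control_set_singleton[where \<sigma> = "- 1"]) (simp_all add: Omega)
    qed
  next
    assume "0 \<notin> \<Omega>"
    then consider "0 < um" | "up < 0"
      using um_less_up by (force simp: Omega)
    then have "C = {}" if "pre_control_set A \<zeta> \<Omega> C" for C
    proof cases
      case 1
      then show ?thesis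
        using that by (intro not_pre_control_set_if_signed[where c = um and \<sigma> = 1]) (simp_all add: Omega)
    next
      case 2
      then show ?thesis
        using that by (intro not_pre_control_set_if_signed[where c = "- up" and \<sigma> = "- 1"]) (simp_all add: Omega)
    qed
    \<comment> \<open>The empty set is vacuously admissible, so the contradiction comes from the
      nonemptiness required of a control set.\<close>
    then show "\<not> (\<exists>C. control_set A \<zeta> \<Omega> C)"
      unfolding control_set_def by blast
  qed
qed

end
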